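(* The graph $G$ described in the context is a planar subcubic graph of girth $11$ with $\chi^2(G)\geq 5$ (that is, $G$ has no $2$-distance $4$-coloring).
   Context: Graphs are finite and simple. A graph is subcubic if its maximum degree is $3$. The girth is the length of a shortest cycle. A $2$-distance $k$-coloring is a coloring of the vertices with $k$ colors such that any two distinct vertices at distance at most $2$ receive different colors; $\chi^2(G)$ is the smallest $k$ such that $G$ has a $2$-distance $k$-coloring. Gadget $G_{\neq}(u,v)$. Its vertices are $u,v$, $u_1,\dots,u_6$, $v_1,\dots,v_8$, $t_1,\dots,t_4$, $w_1,\dots,w_4$, $t'_1,\dots,t'_4$, $t''_1,\dots,t''_4$, $w'_1,\dots,w'_4$, $w''_1,\dots,w''_4$ (all distinct). Its edges are exactly those of the following cycle, paths and edges: - the cycle $u_1u_2u_3u_4u_5u_6v_1v_2v_3v_4v_5u_1$ of length $11$; - the edges $uu_1$, $vu_6$, $v_3v_7$, $v_5v_8$, $v_1v_6$; - the path $u_3t_1t_2t_3t_4v_7$ and the path $u_4w_1w_2w_3w_4v_7$; - the path $t_2t'_1t'_2t'_3t'_4v_8$ and the path $t_3t''_1t''_2t''_3t''_4v_8$; - the path $w_2w'_1w'_2w'_3w'_4v_6$ and the path $w_3w''_1w''_2w''_3w''_4v_6$. Gadget $G'_{\neq}(u,v)$. Take vertices $u,v,x_1,x_2,x_3,x_4$ with edges $vx_1$, $x_1x_2$, $x_2x_3$, $x_2x_4$, and add a copy of $G_{\neq}(u,x_3)$ and a copy of $G_{\neq}(u,x_4)$ (copies of the gadget $G_{\neq}$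 with its two terminals identified with the indicated vertices; the two copies are otherwise disjoint from each other and from the other vertices). Gadget $G_{=}(u,v)$. Take vertices $u,v,y_1,y_2,x_1,x_2,x_3,x_4$ with edges $uy_1$, $y_1y_2$, $y_1x_1$, $vx_1$, $x_1x_2$, $x_2x_3$, $x_2x_4$, and add a copy of $G_{\neq}(y_2,x_3)$ and a copy of $G_{\neq}(y_2,x_4)$ (again otherwise disjoint). The graph $G$ is obtained from two vertices $u,v$ by taking the union of a copy of $G'_{\neq}(u,v)$ and a copy of $G_{=}(u,v)$ that share exactly the vertices $u$ and $v$. *)

theory Defs
  imports "HOL-Analysis.Analysis"
begin

section \<open>Simple graphs\<close>

record 'a ugraph =
  verts :: "'a set"
  edges :: "'a set set"

definition simple_graph :: "'a ugraph \<Rightarrow> bool" where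
  "simple_graph G \<longleftrightarrow> finite (verts G) \<and>
     (\<forall>e\<in>edges G. \<exists>x\<in>verts G. \<exists>y\<in>verts G. x \<noteq> y \<and> e = {x, y})"

definition graph_union :: "'a ugraph \<Rightarrow> 'a ugraph \<Rightarrow> 'a ugraph" where
  "graph_union G H = \<lparr>verts = verts G \<union> verts H, edges = edges G \<union> edges H\<rparr>"

fun path_edges :: "'a list \<Rightarrow> 'a set set" where
  "path_edges (x # y # xs) = insert {x, y} (path_edges (y # xs))"
| "path_edges _ = {}"

definition cycle_edges :: "'a list \<Rightarrow> 'a set set" where
  "cycle_edges xs = path_edges (xs @ [hd xs])"

definition vertex_degree :: "'a ugraph \<Rightarrow> 'a \<Rightarrow> nat" where
  "vertex_degree G v = card {e \<in> edges G. v \<in> e}"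

definition max_degree :: "'a ugraph \<Rightarrow> nat" where
  "max_degree G = Max (vertex_degree G ` verts G)"

definition subcubic :: "'a ugraph \<Rightarrow> bool" where
  "subcubic G \<longleftrightarrow> max_degree G = 3"

definition is_path :: "'a ugraph \<Rightarrow> 'a list \<Rightarrow> bool" where
  "is_path G p \<longleftrightarrow> p \<noteq> [] \<and> distinct p \<and> set p \<subseteq> verts G \<and> path_edges p \<subseteq> edges G"

definition is_cycle :: "'a ugraph \<Rightarrow> 'a list \<Rightarrow> bool" where
  "is_cycle G p \<longleftrightarrow> length p \<ge> 3 \<and> distinct p \<and> set p \<subseteq> verts G \<and> cycle_edges p \<subseteq> edges G"

text \<open>Distance and girth are extended naturals: the infimum over no path, or no cycle, is
  infinity.\<close>

definition graph_dist :: "'a ugraph \<Rightarrow> 'a \<Rightarrow> 'a \<Rightarrow> enat" where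
  "graph_dist G x y =
     (INF p\<in>{p. is_path G p \<and> hd p = x \<and> last p = y}. enat (length p - 1))"

definition girth :: "'a ugraph \<Rightarrow> enat" where
  "girth G = (INF p\<in>{p. is_cycle G p}. enat (length p))"

text \<open>A graph is planar if it can be drawn in the plane: distinct vertices are distinct points,
  an edge is a simple arc between its two ends that meets no other vertex, and two distinct edges
  meet at most in a common end.\<close>

definition planar :: "'a ugraph \<Rightarrow> bool" where
  "planar G \<longleftrightarrow>
     (\<exists>(pos :: 'a \<Rightarrow> real \<times> real) (\<gamma> :: 'a set \<Rightarrow> real \<Rightarrow> real \<times> real).
        inj_on pos (verts G) \<and>
        (\<forall>e\<in>edges G. arc (\<gamma> e) \<and> {pathstart (\<gamma> e), pathfinish (\<gamma> e)} = pos ` e \<and>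
           path_image (\<gamma> e) \<inter> pos ` verts G = pos ` e) \<and>
        (\<forall>e\<in>edges G. \<forall>f\<in>edges G. e \<noteq> f \<longrightarrow>
           path_image (\<gamma> e) \<inter> path_image (\<gamma> f) \<subseteq> pos ` (e \<inter> f)))"

definition two_distance_coloring :: "'a ugraph \<Rightarrow> nat \<Rightarrow> ('a \<Rightarrow> nat) \<Rightarrow> bool" where
  "two_distance_coloring G k c \<longleftrightarrow>
     (\<forall>x\<in>verts G. c x < k) \<and>
     (\<forall>x\<in>verts G. \<forall>y\<in>verts G. x \<noteq> y \<and> graph_dist G x y \<le> 2 \<longrightarrow> c x \<noteq> c y)"

definition two_distance_colorable :: "'a ugraph \<Rightarrow> nat \<Rightarrow> bool" where
  "two_distance_colorable G k \<longleftrightarrow> (\<exists>c. two_distance_coloring G k c)"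

text \<open>On a finite graph some number of colors suffices, so the least one exists.\<close>

definition chi2 :: "'a ugraph \<Rightarrow> nat" where
  "chi2 G = (LEAST k. two_distance_colorable G k)"

section \<open>The gadgets\<close>

text \<open>A gadget is a function of its two terminals \<open>a\<close>, \<open>b\<close> and of a naming \<open>c\<close> of its
  non-terminal vertices. Copies are disjoint outside their terminals because the namings used
  below are injective with pairwise disjoint ranges.\<close>

datatype neq_vertex =
  NU nat | NV nat | NT nat | NW nat | NT' nat | NT'' nat | NW' nat | NW'' nat

definition neq_inner :: "neq_vertex set" where
  "neq_inner = NU ` {1..6} \<union> NV ` {1..8} \<union> NT ` {1..4} \<union> NW ` {1..4} \<union>
     NT' ` {1..4} \<union> NT'' ` {1..4} \<union> NW' ` {1..4} \<union> NW'' ` {1..4}"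

definition neq_gadget :: "(neq_vertex \<Rightarrow> 'a) \<Rightarrow> 'a \<Rightarrow> 'a \<Rightarrow> 'a ugraph" where
  "neq_gadget c a b =
    \<lparr>verts = {a, b} \<union> c ` neq_inner,
     edges =
       cycle_edges (map c [NU 1, NU 2, NU 3, NU 4, NU 5, NU 6, NV 1, NV 2, NV 3, NV 4, NV 5]) \<union>
       {{a, c (NU 1)}, {b, c (NU 6)}, {c (NV 3), c (NV 7)}, {c (NV 5), c (NV 8)},
        {c (NV 1), c (NV 6)}} \<union>
       path_edges (map c [NU 3, NT 1, NT 2, NT 3, NT 4, NV 7]) \<union>
       path_edges (map c [NU 4, NW 1, NW 2, NW 3, NW 4, NV 7]) \<union>
       path_edges (map c [NT 2, NT' 1, NT' 2, NT' 3, NT' 4, NV 8]) \<union>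
       path_edges (map c [NT 3, NT'' 1, NT'' 2, NT'' 3, NT'' 4, NV 8]) \<union>
       path_edges (map c [NW 2, NW' 1, NW' 2, NW' 3, NW' 4, NV 6]) \<union>
       path_edges (map c [NW 3, NW'' 1, NW'' 2, NW'' 3, NW'' 4, NV 6])\<rparr>"

text \<open>\<open>Copy3\<close> and \<open>Copy4\<close> name the inner vertices of the copies of the first gadget that end
  in \<open>X 3\<close> and \<open>X 4\<close>.\<close>

datatype gadget_vertex = X nat | Y nat | Copy3 neq_vertex | Copy4 neq_vertex

definition neq'_gadget :: "(gadget_vertex \<Rightarrow> 'a) \<Rightarrow> 'a \<Rightarrow> 'a \<Rightarrow> 'a ugraph" where
  "neq'_gadget c a b =
     graph_union
       \<lparr>verts = {a, b} \<union> c ` X ` {1..4},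
        edges = {{b, c (X 1)}, {c (X 1), c (X 2)}, {c (X 2), c (X 3)}, {c (X 2), c (X 4)}}\<rparr>
       (graph_union
         (neq_gadget (c \<circ> Copy3) a (c (X 3)))
         (neq_gadget (c \<circ> Copy4) a (c (X 4))))"

definition eq_gadget :: "(gadget_vertex \<Rightarrow> 'a) \<Rightarrow> 'a \<Rightarrow> 'a \<Rightarrow> 'a ugraph" where
  "eq_gadget c a b =
     graph_union
       \<lparr>verts = {a, b} \<union> c ` Y ` {1..2} \<union> c ` X ` {1..4},
        edges = {{a, c (Y 1)}, {c (Y 1), c (Y 2)}, {c (Y 1), c (X 1)}, {b, c (X 1)},
                 {c (X 1), c (X 2)}, {c (X 2), c (X 3)}, {c (X 2), c (X 4)}}\<rparr>
       (graph_union
         (neq_gadget (c \<circ> Copy3) (c (Y 2)) (c (X 3)))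
         (neq_gadget (c \<circ> Copy4) (c (Y 2)) (c (X 4))))"

datatype G_vertex = Term_u | Term_v | In_neq' gadget_vertex | In_eq gadget_vertex

definition G_graph :: "G_vertex ugraph" where
  "G_graph = graph_union (neq'_gadget In_neq' Term_u Term_v) (eq_gadget In_eq Term_u Term_v)"

end

theory Submission
  imports Defs
begin

text \<open>
  In a 2-distance 4-colouring a vertex of degree 3 and its neighbours use all four colours. An
  exhaustive search shows that the terminals of the first gadget always get different colours. Hence
  in the copy of \<open>G'\<^sub>\<noteq>\<close> the vertices \<open>x\<^sub>3, x\<^sub>4\<close> avoid the colour of \<open>u\<close>, which is
  thus the colour of \<open>x\<^sub>1\<close> or \<open>x\<^sub>2\<close> and not the one of \<open>v\<close>. In the copy of \<open>G\<^sub>=\<close>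
  the same argument gives \<open>y\<^sub>2\<close> the colour of \<open>x\<^sub>2\<close>, so \<open>u\<close> and \<open>v\<close> both get the
  colour missing at \<open>x\<^sub>1, x\<^sub>2, y\<^sub>1\<close>, a contradiction. Planarity is witnessed by a
  straight-line drawing with integer coordinates. For the girth, a cycle is traversed from its
  vertex of least rank, so only non-backtracking walks through vertices of larger rank matter.
\<close>

section \<open>Graphs as lists of links\<close>

text \<open>A list of ordered pairs makes the finite checks on the graph executable; the direction
  of a pair carries no meaning.\<close>

definition undirected :: "('a \<times> 'a) list \<Rightarrow> 'a set set" where
  "undirected es = (\<lambda>(x, y). {x, y}) ` set es"

definition endpoints :: "('a \<times> 'a) list \<Rightarrow> 'a set" where
  "endpoints es = fst ` set es \<union> snd ` set es"

definition successive :: "'a list \<Rightarrow> ('a \<times> 'a) list" where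
  "successive xs = zip xs (tl xs)"

lemma undirected_append [simp]: "undirected (es @ fs) = undirected es \<union> undirected fs"
  by (simp add: undirected_def image_Un)

lemma endpoints_append [simp]: "endpoints (es @ fs) = endpoints es \<union> endpoints fs"
  by (auto simp: endpoints_def)

definition linked :: "('a \<times> 'a) list \<Rightarrow> 'a \<Rightarrow> 'a \<Rightarrow> bool" where
  "linked es x y \<longleftrightarrow> list_ex (\<lambda>p. p = (x, y) \<or> p = (y, x)) es"

lemma linked_iff: "linked es x y \<longleftrightarrow> (x, y) \<in> set es \<or> (y, x) \<in> set es"
  by (auto simp: linked_def list_ex_iff)

lemma linked_iff_edge: "linked es x y \<longleftrightarrow> {x, y} \<in> undirected es"
  by (auto simp: linked_iff undirected_def doubleton_eq_iff)

lemma endpoints_successive: "length xs \<ge> 2 \<Longrightarrow> endpoints (successive xs) = set xs"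
proof (induction xs rule: path_edges.induct)
  case (1 x y xs)
  then show ?case
    by (cases xs) (auto simp: endpoints_def successive_def)
qed auto

lemma path_edges_eq_undirected: "path_edges xs = undirected (successive xs)"
  by (induction xs rule: path_edges.induct) (auto simp: undirected_def successive_def)

text \<open>The order follows the edge set of \<open>neq_gadget\<close>; the ring repeats
  \<open>NU 1\<close> at its end because \<open>cycle_edges\<close> closes a list with its
  head.\<close>

definition neq_links :: "(neq_vertex \<Rightarrow> 'a) \<Rightarrow> 'a \<Rightarrow> 'a \<Rightarrow> ('a \<times> 'a) list" where
  "neq_links c a b =
    successive (map c [NU 1, NU 2, NU 3, NU 4, NU 5, NU 6, NV 1, NV 2, NV 3, NV 4, NV 5, NU 1]) @
    [(a, c (NU 1)), (b, c (NU 6)), (c (NV 3), c (NV 7)), (c (NV 5), c (NV 8)),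
     (c (NV 1), c (NV 6))] @
    successive (map c [NU 3, NT 1, NT 2, NT 3, NT 4, NV 7]) @
    successive (map c [NU 4, NW 1, NW 2, NW 3, NW 4, NV 7]) @
    successive (map c [NT 2, NT' 1, NT' 2, NT' 3, NT' 4, NV 8]) @
    successive (map c [NT 3, NT'' 1, NT'' 2, NT'' 3, NT'' 4, NV 8]) @
    successive (map c [NW 2, NW' 1, NW' 2, NW' 3, NW' 4, NV 6]) @
    successive (map c [NW 3, NW'' 1, NW'' 2, NW'' 3, NW'' 4, NV 6])"

lemma edges_neq_gadget: "edges (neq_gadget c a b) = undirected (neq_links c a b)"
  by (simp only: neq_gadget_def neq_links_def cycle_edges_def path_edges_eq_undirected
      undirected_append ugraph.simps list.map append.simps list.sel)
    (simp add: undirected_def Un_assoc image_Un)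

text \<open>There are no isolated vertices: the terminals lie on their pendant links, all others on
  the ring or on one of the paths.\<close>

lemma verts_neq_gadget: "verts (neq_gadget c a b) = endpoints (neq_links c a b)"
proof -
  let ?inner = "[NU 1, NU 2, NU 3, NU 4, NU 5, NU 6, NV 1, NV 2, NV 3, NV 4, NV 5, NU 1] @
      [NU 3, NT 1, NT 2, NT 3, NT 4, NV 7] @ [NU 4, NW 1, NW 2, NW 3, NW 4, NV 7] @
      [NT 2, NT' 1, NT' 2, NT' 3, NT' 4, NV 8] @ [NT 3, NT'' 1, NT'' 2, NT'' 3, NT'' 4, NV 8] @
      [NW 2, NW' 1, NW' 2, NW' 3, NW' 4, NV 6] @ [NW 3, NW'' 1, NW'' 2, NW'' 3, NW'' 4, NV 6]"
  have inner: "neq_inner = set ?inner"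
    by code_simp
  have "endpoints (neq_links c a b) = {a, b} \<union> c ` set ?inner"
    unfolding neq_links_def endpoints_append
    by (simp add: endpoints_successive) (simp add: endpoints_def Un_ac insert_commute)
  then show ?thesis
    by (simp add: neq_gadget_def inner)
qed

definition G_links :: "(G_vertex \<times> G_vertex) list" where
  "G_links =
     map (map_prod In_neq' In_neq')
       [(X 1, X 2), (X 2, X 3), (X 2, X 4)] @
     [(Term_v, In_neq' (X 1))] @
     neq_links (In_neq' \<circ> Copy3) Term_u (In_neq' (X 3)) @
     neq_links (In_neq' \<circ> Copy4) Term_u (In_neq' (X 4)) @
     [(Term_u, In_eq (Y 1)), (Term_v, In_eq (X 1))] @
     map (map_prod In_eq In_eq) [(Y 1, Y 2), (Y 1, X 1), (X 1, X 2), (X 2, X 3), (X 2, X 4)] @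
     neq_links (In_eq \<circ> Copy3) (In_eq (Y 2)) (In_eq (X 3)) @
     neq_links (In_eq \<circ> Copy4) (In_eq (Y 2)) (In_eq (X 4))"

lemma edges_G_graph: "edges G_graph = undirected G_links"
  unfolding G_graph_def neq'_gadget_def eq_gadget_def graph_union_def ugraph.simps
    edges_neq_gadget G_links_def undirected_append
  by (simp add: undirected_def Un_ac insert_commute)

lemma verts_G_graph: "verts G_graph = endpoints G_links"
proof -
  have terminals: "a \<in> endpoints (neq_links c a b)" "b \<in> endpoints (neq_links c a b)" for c a b
    by (auto simp: verts_neq_gadget [symmetric] neq_gadget_def)
  have ranges: "{1..4::nat} = {1, 2, 3, 4}" "{1..2::nat} = {1, 2}"
    by auto
  show ?thesis
    unfolding G_graph_def neq'_gadget_def eq_gadget_def graph_union_def ugraph.simps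
      verts_neq_gadget G_links_def endpoints_append ranges
    by (auto simp: endpoints_def [of "(x, y) # es" for x y es] endpoints_def [of "[]"] terminals)
qed

definition neq_vertices :: "neq_vertex list" where
  "neq_vertices = map NU [1..<7] @ map NV [1..<9] @ map NT [1..<5] @ map NW [1..<5] @
     map NT' [1..<5] @ map NT'' [1..<5] @ map NW' [1..<5] @ map NW'' [1..<5]"

text \<open>Each vertex appears once, so distinctness of the list of positions expresses injectivity
  of the drawing.\<close>

definition G_vertices :: "G_vertex list" where
  "G_vertices = [Term_u, Term_v] @
     map In_neq' (map X [1..<5] @ map Copy3 neq_vertices @ map Copy4 neq_vertices) @
     map In_eq (map Y [1..<3] @ map X [1..<5] @ map Copy3 neq_vertices @ map Copy4 neq_vertices)"

lemma verts_G_graph_list: "verts G_graph = set G_vertices"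
proof -
  have "neq_inner = set neq_vertices"
    by (auto simp: neq_inner_def neq_vertices_def)
  moreover have "{1..4::nat} = set [1..<5]" "{1..2::nat} = set [1..<3]" by auto
  ultimately show ?thesis
    unfolding G_graph_def neq'_gadget_def eq_gadget_def graph_union_def ugraph.simps
      neq_gadget_def G_vertices_def set_append set_map
    by auto
qed

lemma G_links_loopless: "(x, y) \<in> set G_links \<Longrightarrow> x \<noteq> y"
proof -
  have "list_all (\<lambda>(x, y). x \<noteq> y) G_links" by code_simp
  then show "(x, y) \<in> set G_links \<Longrightarrow> x \<noteq> y" by (auto simp: list_all_iff)
qed

lemma simple_graph_G_graph: "simple_graph G_graph"
proof -
  have "finite (verts G_graph)"
    by (simp add: verts_G_graph_list)
  moreover have "\<exists>x\<in>verts G_graph. \<exists>y\<in>verts G_graph. x \<noteq> y \<and> e = {x, y}"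
    if e: "e \<in> edges G_graph" for e
  proof -
    obtain x y where "(x, y) \<in> set G_links" "e = {x, y}"
      using e by (auto simp: edges_G_graph undirected_def)
    with G_links_loopless show ?thesis
      unfolding verts_G_graph endpoints_def by force
  qed
  ultimately show ?thesis
    by (simp add: simple_graph_def)
qed

section \<open>Planarity\<close>

type_synonym point = "int \<times> int"
type_synonym segment = "point \<times> point"

definition real_point :: "point \<Rightarrow> real \<times> real" where
  "real_point p = (real_of_int (fst p), real_of_int (snd p))"

definition real_segment :: "segment \<Rightarrow> (real \<times> real) set" where
  "real_segment s = closed_segment (real_point (fst s)) (real_point (snd s))"

definition real_ends :: "segment \<Rightarrow> (real \<times> real) set" where
  "real_ends s = {real_point (fst s), real_point (snd s)}"

text \<open>The cross product of \<open>q - p\<close> and \<open>r - p\<close>; its sign tells on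
  which side of the line through \<open>p\<close> and \<open>q\<close> the point \<open>r\<close>
  lies.\<close>

definition orient :: "point \<Rightarrow> point \<Rightarrow> point \<Rightarrow> int" where
  "orient p q r = (fst q - fst p) * (snd r - snd p) - (snd q - snd p) * (fst r - fst p)"

definition same_side :: "segment \<Rightarrow> segment \<Rightarrow> bool" where
  "same_side s t \<longleftrightarrow> 0 < orient (fst s) (snd s) (fst t) * orient (fst s) (snd s) (snd t)"

text \<open>For collinear points the dot product decides: it is negative exactly when
  \<open>p\<close> lies strictly between \<open>q\<close> and \<open>r\<close>.\<close>

definition diverge :: "point \<Rightarrow> point \<Rightarrow> point \<Rightarrow> bool" where
  "diverge p q r \<longleftrightarrow> orient p q r \<noteq> 0 \<or>
     (fst q - fst p) * (fst r - fst p) + (snd q - snd p) * (snd r - snd p) < 0"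

definition before :: "(point \<Rightarrow> int) \<Rightarrow> segment \<Rightarrow> segment \<Rightarrow> bool" where
  "before f s t \<longleftrightarrow> f (fst s) < f (fst t) \<and> f (fst s) < f (snd t) \<and>
     f (snd s) < f (fst t) \<and> f (snd s) < f (snd t)"

text \<open>Collinear segments are beyond the orientation test, hence the comparison of coordinates.\<close>

definition compatible :: "segment \<Rightarrow> segment \<Rightarrow> bool" where
  "compatible s t \<longleftrightarrow> before fst s t \<or> before fst t s \<or> before snd s t \<or> before snd t s \<or>
     same_side s t \<or> same_side t s \<or>
     fst s = fst t \<and> diverge (fst s) (snd s) (snd t) \<or>
     fst s = snd t \<and> diverge (fst s) (snd s) (fst t) \<or>
     snd s = fst t \<and> diverge (snd s) (fst s) (snd t) \<or>
     snd s = snd t \<and> diverge (snd s) (fst s) (fst t)"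

lemma real_point_eq_iff [simp]: "real_point p = real_point q \<longleftrightarrow> p = q"
  by (auto simp: real_point_def prod_eq_iff)

lemma real_segment_cases:
  assumes "z \<in> real_segment s"
  obtains t where "0 \<le> t" "t \<le> 1"
    "fst z = (1 - t) * real_of_int (fst (fst s)) + t * real_of_int (fst (snd s))"
    "snd z = (1 - t) * real_of_int (snd (fst s)) + t * real_of_int (snd (snd s))"
  using assms by (auto simp: real_segment_def closed_segment_def real_point_def)

lemma real_segment_swap: "real_segment (q, p) = real_segment (p, q)"
  by (simp add: real_segment_def closed_segment_commute)

lemma real_segment_bounds:
  assumes "z \<in> real_segment s"
  shows "real_of_int (min (fst (fst s)) (fst (snd s))) \<le> fst z"
    and "fst z \<le> real_of_int (max (fst (fst s)) (fst (snd s)))"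
    and "real_of_int (min (snd (fst s)) (snd (snd s))) \<le> snd z"
    and "snd z \<le> real_of_int (max (snd (fst s)) (snd (snd s)))"
proof -
  have between: "min x y \<le> (1 - t) * x + t * y" "(1 - t) * x + t * y \<le> max x y"
    if "0 \<le> t" "t \<le> 1" for x y t :: real
  proof -
    have "(1 - t) * min x y + t * min x y \<le> (1 - t) * x + t * y"
      "(1 - t) * x + t * y \<le> (1 - t) * max x y + t * max x y"
      using that by (auto intro!: add_mono mult_left_mono)
    then show "min x y \<le> (1 - t) * x + t * y" "(1 - t) * x + t * y \<le> max x y"
      by (simp_all add: algebra_simps)
  qed
  obtain t where t: "0 \<le> t" "t \<le> 1"
    "fst z = (1 - t) * real_of_int (fst (fst s)) + t * real_of_int (fst (snd s))"
    "snd z = (1 - t) * real_of_int (snd (fst s)) + t * real_of_int (snd (snd s))"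
    using real_segment_cases [OF assms] by metis
  then show "real_of_int (min (fst (fst s)) (fst (snd s))) \<le> fst z"
    "fst z \<le> real_of_int (max (fst (fst s)) (fst (snd s)))"
    "real_of_int (min (snd (fst s)) (snd (snd s))) \<le> snd z"
    "snd z \<le> real_of_int (max (snd (fst s)) (snd (snd s)))"
    by (simp_all add: between of_int_min of_int_max)
qed

lemma before_disjoint:
  assumes "z \<in> real_segment s" "z \<in> real_segment t"
  shows "\<not> before fst s t" "\<not> before snd s t"
  using real_segment_bounds [OF assms(1)] real_segment_bounds [OF assms(2)]
  unfolding before_def by linarith+

text \<open>The orientation with respect to \<open>s\<close> is an affine function of its last
  argument and vanishes along \<open>s\<close>. On \<open>t\<close> it is a convex combination of
  two nonzero numbers of equal sign, hence never zero.\<close>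

lemma same_side_disjoint:
  assumes "same_side s t" "z \<in> real_segment s" "z \<in> real_segment t"
  shows False
proof -
  obtain a where a:
    "fst z = (1 - a) * real_of_int (fst (fst s)) + a * real_of_int (fst (snd s))"
    "snd z = (1 - a) * real_of_int (snd (fst s)) + a * real_of_int (snd (snd s))"
    using real_segment_cases [OF assms(2)] by metis
  obtain b where b: "0 \<le> b" "b \<le> 1"
    "fst z = (1 - b) * real_of_int (fst (fst t)) + b * real_of_int (fst (snd t))"
    "snd z = (1 - b) * real_of_int (snd (fst t)) + b * real_of_int (snd (snd t))"
    using real_segment_cases [OF assms(3)] by metis
  define f where "f = real_of_int (orient (fst s) (snd s) (fst t))"
  define g where "g = real_of_int (orient (fst s) (snd s) (snd t))"
  have "0 = (real_of_int (fst (snd s)) - fst (fst s)) * (snd z - snd (fst s))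
      - (real_of_int (snd (snd s)) - snd (fst s)) * (fst z - fst (fst s))"
    unfolding a by algebra
  also have "\<dots> = (1 - b) * f + b * g"
    unfolding b f_def g_def orient_def of_int_mult of_int_diff by algebra
  finally have eq: "(1 - b) * f + b * g = 0" by simp
  have "0 < real_of_int (orient (fst s) (snd s) (fst t) * orient (fst s) (snd s) (snd t))"
    using assms(1) unfolding same_side_def by linarith
  then have "0 < f * g"
    by (simp add: f_def g_def)
  then consider "f > 0" "g > 0" | "f < 0" "g < 0"
    by (auto simp: zero_less_mult_iff)
  then show False
  proof cases
    case 1
    then have "(1 - b) * f \<ge> 0" "b * g \<ge> 0" "b = 0 \<or> b * g > 0"
      using b(1,2) by (auto simp: zero_less_mult_iff)
    with 1 eq show False by auto
  next
    case 2
    then have "(1 - b) * f \<le> 0" "b * g \<le> 0" "b = 0 \<or> b * g < 0"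
      using b(1,2) by (auto simp: mult_le_0_iff mult_less_0_iff)
    with 2 eq show False by auto
  qed
qed

text \<open>Write \<open>z - p\<close> as \<open>a\<close> times \<open>q - p\<close> and as
  \<open>b\<close> times \<open>r - p\<close>. The cross product with \<open>q - p\<close> forces
  \<open>b = 0\<close> unless the points are collinear; in that case the squared length of
  \<open>z - p\<close> is \<open>a * b\<close> times a negative number.\<close>

lemma diverge_meet:
  assumes "diverge p q r" "z \<in> real_segment (p, q)" "z \<in> real_segment (p, r)"
  shows "z = real_point p"
proof -
  obtain a where a: "0 \<le> a"
    "fst z = (1 - a) * real_of_int (fst p) + a * real_of_int (fst q)"
    "snd z = (1 - a) * real_of_int (snd p) + a * real_of_int (snd q)"
    using real_segment_cases [OF assms(2)] by (metis fst_conv snd_conv)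
  obtain b where b: "0 \<le> b"
    "fst z = (1 - b) * real_of_int (fst p) + b * real_of_int (fst r)"
    "snd z = (1 - b) * real_of_int (snd p) + b * real_of_int (snd r)"
    using real_segment_cases [OF assms(3)] by (metis fst_conv snd_conv)
  have "b * real_of_int (orient p q r) =
      (real_of_int (fst q) - fst p) * (snd z - snd p) - (real_of_int (snd q) - snd p) * (fst z - fst p)"
    unfolding b orient_def of_int_mult of_int_diff by algebra
  also have "\<dots> = 0"
    unfolding a by algebra
  finally have orient: "b * real_of_int (orient p q r) = 0" .
  have dot: "(fst z - fst p) * (fst z - fst p) + (snd z - snd p) * (snd z - snd p) =
     a * b * real_of_int ((fst q - fst p) * (fst r - fst p) + (snd q - snd p) * (snd r - snd p))"
  proof -
    have "fst z - fst p = a * (real_of_int (fst q) - fst p)"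
         "snd z - snd p = a * (real_of_int (snd q) - snd p)"
      unfolding a by algebra+
    moreover have "fst z - fst p = b * (real_of_int (fst r) - fst p)"
         "snd z - snd p = b * (real_of_int (snd r) - snd p)"
      unfolding b by algebra+
    ultimately show ?thesis
      unfolding of_int_mult of_int_diff of_int_add by algebra
  qed
  show ?thesis
  proof (cases "orient p q r = 0")
    case False
    with orient have "b = 0" by simp
    with b show ?thesis by (simp add: real_point_def prod_eq_iff)
  next
    case True
    with assms(1) have "(fst q - fst p) * (fst r - fst p) + (snd q - snd p) * (snd r - snd p) < 0"
      by (simp add: diverge_def)
    then have "a * b * real_of_int ((fst q - fst p) * (fst r - fst p) + (snd q - snd p) * (snd r - snd p)) \<le> 0"
      using a b by (intro mult_nonneg_nonpos) (auto simp del: of_int_add of_int_mult of_int_diff)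
    with dot have "(fst z - fst p) * (fst z - fst p) + (snd z - snd p) * (snd z - snd p) \<le> 0" by linarith
    then show ?thesis by (simp add: real_point_def prod_eq_iff sum_squares_le_zero_iff)
  qed
qed

lemma compatible_meet:
  assumes "compatible s t" "z \<in> real_segment s" "z \<in> real_segment t"
  shows "z \<in> real_ends s \<inter> real_ends t"
proof -
  obtain p q where s: "s = (p, q)" by (cases s)
  obtain r u where t: "t = (r, u)" by (cases t)
  \<comment> \<open>\<open>diverge_meet\<close> expects both segments to start at the common end, so
    the reversed segments are needed too.\<close>
  have "z \<in> real_segment (q, p)" "z \<in> real_segment (u, r)"
    using assms(2,3) by (simp_all add: s t real_segment_swap)
  then show ?thesis
    using assms unfolding compatible_def real_ends_def
    by (auto simp: s t before_disjoint dest: same_side_disjoint diverge_meet)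
qed

fun pairwise_compatible :: "segment list \<Rightarrow> bool" where
  "pairwise_compatible [] = True"
| "pairwise_compatible (s # ss) = (list_all (compatible s) ss \<and> pairwise_compatible ss)"

text \<open>Two segments that meet at a point on one side of an axis-parallel line both reach that
  side, so it suffices to compare segments within each cell of a subdivision of the plane.\<close>

datatype cut = Uncut | Cut_X int cut cut | Cut_Y int cut cut

primrec noncrossing :: "cut \<Rightarrow> segment list \<Rightarrow> bool" where
  "noncrossing Uncut ss = pairwise_compatible ss"
| "noncrossing (Cut_X k l r) ss =
     (noncrossing l (filter (\<lambda>s. fst (fst s) \<le> k \<or> fst (snd s) \<le> k) ss) \<and>
      noncrossing r (filter (\<lambda>s. k \<le> fst (fst s) \<or> k \<le> fst (snd s)) ss))"
| "noncrossing (Cut_Y k l r) ss =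
     (noncrossing l (filter (\<lambda>s. snd (fst s) \<le> k \<or> snd (snd s) \<le> k) ss) \<and>
      noncrossing r (filter (\<lambda>s. k \<le> snd (fst s) \<or> k \<le> snd (snd s)) ss))"

lemma pairwise_compatible_meet:
  assumes "pairwise_compatible ss" "s \<in> set ss" "t \<in> set ss" "s \<noteq> t"
    "z \<in> real_segment s" "z \<in> real_segment t"
  shows "z \<in> real_ends s \<inter> real_ends t"
  using assms
proof (induction ss)
  case (Cons a ss)
  have "compatible s t \<or> compatible t s \<or> s \<in> set ss \<and> t \<in> set ss"
    using Cons.prems by (auto simp: list_all_iff)
  then consider "compatible s t" | "compatible t s" | "s \<in> set ss" "t \<in> set ss"
    by blast
  then show ?case
  proof cases
    case 3
    with Cons.prems show ?thesis by (intro Cons.IH) auto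
  qed (use Cons.prems compatible_meet in blast)+
qed simp

text \<open>Descend to a cell containing \<open>z\<close>: by the coordinate bounds, a segment
  through \<open>z\<close> has an end on the chosen closed side of each line, so neither
  \<open>s\<close> nor \<open>t\<close> is filtered out.\<close>

lemma noncrossing_meet:
  assumes "noncrossing c ss" "s \<in> set ss" "t \<in> set ss" "s \<noteq> t"
    "z \<in> real_segment s" "z \<in> real_segment t"
  shows "z \<in> real_ends s \<inter> real_ends t"
  using assms
proof (induction c arbitrary: ss)
  case Uncut
  then show ?case by (intro pairwise_compatible_meet) auto
next
  case (Cut_X k l r)
  show ?case
  proof (cases "fst z \<le> real_of_int k")
    case True
    then have "fst (fst u) \<le> k \<or> fst (snd u) \<le> k" if "z \<in> real_segment u" for u
      using real_segment_bounds [OF that] by linarith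
    with Cut_X.prems show ?thesis
      by (intro Cut_X.IH(1) [of "filter (\<lambda>s. fst (fst s) \<le> k \<or> fst (snd s) \<le> k) ss"]) auto
  next
    case False
    then have "k \<le> fst (fst u) \<or> k \<le> fst (snd u)" if "z \<in> real_segment u" for u
      using real_segment_bounds [OF that] by linarith
    with Cut_X.prems show ?thesis
      by (intro Cut_X.IH(2) [of "filter (\<lambda>s. k \<le> fst (fst s) \<or> k \<le> fst (snd s)) ss"]) auto
  qed
next
  case (Cut_Y k l r)
  show ?case
  proof (cases "snd z \<le> real_of_int k")
    case True
    then have "snd (fst u) \<le> k \<or> snd (snd u) \<le> k" if "z \<in> real_segment u" for u
      using real_segment_bounds [OF that] by linarith
    with Cut_Y.prems show ?thesis
      by (intro Cut_Y.IH(1) [of "filter (\<lambda>s. snd (fst s) \<le> k \<or> snd (snd s) \<le> k) ss"]) auto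
  next
    case False
    then have "k \<le> snd (fst u) \<or> k \<le> snd (snd u)" if "z \<in> real_segment u" for u
      using real_segment_bounds [OF that] by linarith
    with Cut_Y.prems show ?thesis
      by (intro Cut_Y.IH(2) [of "filter (\<lambda>s. k \<le> snd (fst s) \<or> k \<le> snd (snd s)) ss"]) auto
  qed
qed

section \<open>From segments to a plane drawing\<close>

lemma planar_if_noncrossing:
  fixes place :: "'a \<Rightarrow> point"
  assumes V: "verts G = endpoints es" and E: "edges G = undirected es"
    and loopless: "\<And>x y. (x, y) \<in> set es \<Longrightarrow> x \<noteq> y"
    and inj: "inj_on place (endpoints es)"
    and nc: "noncrossing c (map (map_prod place place) es)"
  shows "planar G"
proof -
  \<comment> \<open>An edge is unordered; choosing one of its links fixes the direction of its
    arc.\<close>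
  define link where "link e = (SOME p. p \<in> set es \<and> e = {fst p, snd p})" for e
  have link: "link e \<in> set es" "e = {fst (link e), snd (link e)}" if "e \<in> edges G" for e
  proof -
    from that have "\<exists>p. p \<in> set es \<and> e = {fst p, snd p}"
      by (auto simp: E undirected_def)
    then have "link e \<in> set es \<and> e = {fst (link e), snd (link e)}"
      unfolding link_def by (rule someI_ex)
    then show "link e \<in> set es" "e = {fst (link e), snd (link e)}" by auto
  qed
  define pos where "pos x = real_point (place x)" for x
  define \<gamma> where "\<gamma> e = linepath (pos (fst (link e))) (pos (snd (link e)))" for e
  have inj_pos: "inj_on pos (verts G)"
    using inj by (auto simp: inj_on_def pos_def V)
  have sub: "e \<subseteq> verts G" if "e \<in> edges G" for e
    using link [OF that] by (auto simp: V endpoints_def)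
  have seg: "path_image (\<gamma> e) = real_segment (map_prod place place (link e))" for e
    by (simp add: \<gamma>_def pos_def real_segment_def)
  have ends: "real_ends (map_prod place place (link e)) = pos ` e" if "e \<in> edges G" for e
  proof -
    have "real_ends (map_prod place place (link e)) = pos ` {fst (link e), snd (link e)}"
      by (simp add: real_ends_def pos_def)
    then show ?thesis
      unfolding link(2) [OF that, symmetric] .
  qed
  have meet: "path_image (\<gamma> e) \<inter> path_image (\<gamma> f) \<subseteq> pos ` (e \<inter> f)"
    if "e \<in> edges G" "f \<in> edges G" "e \<noteq> f" for e f
  proof
    fix z assume z: "z \<in> path_image (\<gamma> e) \<inter> path_image (\<gamma> f)"
    \<comment> \<open>Distinct edges must yield distinct segments before
      \<open>noncrossing_meet\<close> applies; this follows from injectivity of the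
      positions.\<close>
    have "pos ` e \<noteq> pos ` f"
      using inj_on_image_eq_iff [OF inj_pos] sub that by blast
    then have "map_prod place place (link e) \<noteq> map_prod place place (link f)"
      using ends that by metis
    then have "z \<in> pos ` e \<inter> pos ` f"
      using noncrossing_meet [OF nc, of "map_prod place place (link e)" "map_prod place place (link f)" z]
        link that z by (simp add: seg ends)
    then show "z \<in> pos ` (e \<inter> f)"
      using inj_on_image_Int [OF inj_pos] sub that by metis
  qed
  have vertices: "path_image (\<gamma> e) \<inter> pos ` verts G = pos ` e" if e: "e \<in> edges G" for e
  proof (intro equalityI subsetI)
    fix z assume z: "z \<in> path_image (\<gamma> e) \<inter> pos ` verts G"
    then obtain x where x: "x \<in> verts G" "z = pos x" by auto
    \<comment> \<open>A vertex on the arc of \<open>e\<close> is an end of some edge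
      \<open>f\<close>, hence also on the arc of \<open>f\<close>, which reduces the claim to
      \<open>meet\<close>.\<close>
    then obtain f where f: "f \<in> edges G" "x \<in> f"
      by (force simp: V E endpoints_def undirected_def)
    have "z \<in> path_image (\<gamma> f)"
    proof -
      have "x \<in> {fst (link f), snd (link f)}"
        using f(2) link(2) [OF f(1)] by (rule back_subst)
      then show ?thesis
        by (auto simp: \<gamma>_def x)
    qed
    with z meet [OF e f(1)] x f show "z \<in> pos ` e" by (cases "e = f") auto
  next
    fix z assume "z \<in> pos ` e"
    then show "z \<in> path_image (\<gamma> e) \<inter> pos ` verts G"
    proof -
      obtain x where x: "x \<in> e" "z = pos x"
        using \<open>z \<in> pos ` e\<close> by blast
      have "x \<in> {fst (link e), snd (link e)}"
        using x(1) link(2) [OF e] by (rule back_subst)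
      with x sub [OF e] show ?thesis
        by (auto simp: \<gamma>_def)
    qed
  qed
  have "arc (\<gamma> e) \<and> {pathstart (\<gamma> e), pathfinish (\<gamma> e)} = pos ` e" if "e \<in> edges G" for e
  proof -
    have "fst (link e) \<noteq> snd (link e)"
      using link(1) [OF that] loopless by (metis prod.collapse)
    moreover have "fst (link e) \<in> verts G" "snd (link e) \<in> verts G"
      using link [OF that] sub [OF that] by auto
    ultimately have "pos (fst (link e)) \<noteq> pos (snd (link e))"
      using inj_pos by (meson inj_onD)
    moreover have "pos ` e = {pos (fst (link e)), pos (snd (link e))}"
      using link(2) [OF that] by (metis image_empty image_insert)
    ultimately show ?thesis by (simp add: \<gamma>_def arc_linepath)
  qed
  with inj_pos vertices meet show ?thesis
    unfolding planar_def by (intro exI [of _ pos] exI [of _ \<gamma>]) auto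
qed

text \<open>The ring bounds the rectangle with corners \<open>NU 1\<close>, \<open>NU 6\<close>,
  \<open>NV 2\<close>, \<open>NV 4\<close> and encloses all other inner vertices. The part named
  \<open>NW\<close> mirrors the part named \<open>NT\<close> in the horizontal axis; the terminals
  attach from outside at the two left corners.\<close>

primrec neq_place :: "neq_vertex \<Rightarrow> point" where
  "neq_place (NU i) = [(0, 7), (0, 4), (0, 1), (0, - 1), (0, - 4), (0, - 7)] ! (i - 1)"
| "neq_place (NV i) =
    [(4, - 7), (9, - 7), (9, 0), (9, 7), (4, 7), (4, - 6), (8, 0), (4, 6)] ! (i - 1)"
| "neq_place (NT i) = [(1, 1), (2, 1), (6, 1), (7, 1)] ! (i - 1)"
| "neq_place (NW i) = [(1, - 1), (2, - 1), (6, - 1), (7, - 1)] ! (i - 1)"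
| "neq_place (NT' i) = (2, int i + 1)"
| "neq_place (NT'' i) = (6, int i + 1)"
| "neq_place (NW' i) = (2, - int i - 1)"
| "neq_place (NW'' i) = (6, - int i - 1)"

definition shift :: "int \<Rightarrow> point \<Rightarrow> point" where
  "shift d p = (fst p + d, snd p)"

text \<open>\<open>Y i\<close> does not occur in the second gadget, hence its dummy value.\<close>

primrec neq'_place :: "gadget_vertex \<Rightarrow> point" where
  "neq'_place (X i) = [(- 10, 12), (- 10, - 10), (0, - 8), (20, - 8)] ! (i - 1)"
| "neq'_place (Y i) = (0, 0)"
| "neq'_place (Copy3 n) = neq_place n"
| "neq'_place (Copy4 n) = shift 20 (neq_place n)"

primrec eq_place :: "gadget_vertex \<Rightarrow> point" where
  "eq_place (X i) = [(80, 9), (80, - 10), (40, - 8), (60, - 8)] ! (i - 1)"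
| "eq_place (Y i) = [(50, 9), (50, 8)] ! (i - 1)"
| "eq_place (Copy3 n) = shift 40 (neq_place n)"
| "eq_place (Copy4 n) = shift 60 (neq_place n)"

text \<open>Four translates of the gadget stand side by side. The shared terminal of each pair,
  \<open>Term_u\<close> or \<open>Y 2\<close>, sits above and midway between their left corners;
  \<open>X 3\<close> and \<open>X 4\<close> hang below. The edges from \<open>X 1\<close> to
  \<open>X 2\<close> run down the far left and far right, and the edge from \<open>Term_v\<close> to
  the left \<open>X 1\<close> passes above everything at height 12.\<close>

primrec G_place :: "G_vertex \<Rightarrow> point" where
  "G_place Term_u = (10, 9)"
| "G_place Term_v = (80, 12)"
| "G_place (In_neq' x) = neq'_place x"
| "G_place (In_eq x) = eq_place x"

definition gadget_cut :: "int \<Rightarrow> cut" where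
  "gadget_cut d = Cut_Y 0
     (Cut_X (d + 4) (Cut_Y (- 3) Uncut Uncut) (Cut_Y (- 3) Uncut Uncut))
     (Cut_X (d + 4) (Cut_Y 3 Uncut Uncut) (Cut_Y 3 Uncut Uncut))"

definition G_cut :: cut where
  "G_cut = Cut_X 35 (Cut_X 15 (gadget_cut 0) (gadget_cut 20)) (Cut_X 55 (gadget_cut 40) (gadget_cut 60))"

lemma G_noncrossing: "noncrossing G_cut (map (map_prod G_place G_place) G_links)"
  by code_simp

lemma distinct_G_place: "distinct (map G_place G_vertices)"
  by code_simp

lemma planar_G_graph: "planar G_graph"
  using verts_G_graph edges_G_graph G_links_loopless _ G_noncrossing
proof (rule planar_if_noncrossing)
  show "inj_on G_place (endpoints G_links)"
    using distinct_G_place by (simp add: distinct_map flip: verts_G_graph verts_G_graph_list)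
qed

section \<open>Degrees and girth\<close>

primrec neq_neighbours :: "(neq_vertex \<Rightarrow> 'a) \<Rightarrow> 'a \<Rightarrow> 'a \<Rightarrow> neq_vertex \<Rightarrow> 'a list" where
  "neq_neighbours c a b (NU i) =
     [[a, c (NU 2), c (NV 5)], [c (NU 1), c (NU 3)], [c (NU 2), c (NU 4), c (NT 1)],
      [c (NU 3), c (NU 5), c (NW 1)], [c (NU 4), c (NU 6)], [c (NU 5), c (NV 1), b]] ! (i - 1)"
| "neq_neighbours c a b (NV i) =
     [[c (NU 6), c (NV 2), c (NV 6)], [c (NV 1), c (NV 3)], [c (NV 2), c (NV 4), c (NV 7)],
      [c (NV 3), c (NV 5)], [c (NV 4), c (NU 1), c (NV 8)], [c (NV 1), c (NW' 4), c (NW'' 4)],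
      [c (NV 3), c (NT 4), c (NW 4)], [c (NV 5), c (NT' 4), c (NT'' 4)]] ! (i - 1)"
| "neq_neighbours c a b (NT i) =
     [[c (NU 3), c (NT 2)], [c (NT 1), c (NT 3), c (NT' 1)], [c (NT 2), c (NT 4), c (NT'' 1)],
      [c (NT 3), c (NV 7)]] ! (i - 1)"
| "neq_neighbours c a b (NW i) =
     [[c (NU 4), c (NW 2)], [c (NW 1), c (NW 3), c (NW' 1)], [c (NW 2), c (NW 4), c (NW'' 1)],
      [c (NW 3), c (NV 7)]] ! (i - 1)"
| "neq_neighbours c a b (NT' i) =
     [[c (NT 2), c (NT' 2)], [c (NT' 1), c (NT' 3)], [c (NT' 2), c (NT' 4)],
      [c (NT' 3), c (NV 8)]] ! (i - 1)"
| "neq_neighbours c a b (NT'' i) =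
     [[c (NT 3), c (NT'' 2)], [c (NT'' 1), c (NT'' 3)], [c (NT'' 2), c (NT'' 4)],
      [c (NT'' 3), c (NV 8)]] ! (i - 1)"
| "neq_neighbours c a b (NW' i) =
     [[c (NW 2), c (NW' 2)], [c (NW' 1), c (NW' 3)], [c (NW' 2), c (NW' 4)],
      [c (NW' 3), c (NV 6)]] ! (i - 1)"
| "neq_neighbours c a b (NW'' i) =
     [[c (NW 3), c (NW'' 2)], [c (NW'' 1), c (NW'' 3)], [c (NW'' 2), c (NW'' 4)],
      [c (NW'' 3), c (NV 6)]] ! (i - 1)"

text \<open>The entry for \<open>Y i\<close> is a dummy: these vertices are absent from this
  gadget.\<close>

primrec neq'_neighbours :: "gadget_vertex \<Rightarrow> G_vertex list" where
  "neq'_neighbours (X i) =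
     [[Term_v, In_neq' (X 2)], map In_neq' [X 1, X 3, X 4],
      map In_neq' [X 2, Copy3 (NU 6)], map In_neq' [X 2, Copy4 (NU 6)]] ! (i - 1)"
| "neq'_neighbours (Y i) = []"
| "neq'_neighbours (Copy3 n) = neq_neighbours (In_neq' \<circ> Copy3) Term_u (In_neq' (X 3)) n"
| "neq'_neighbours (Copy4 n) = neq_neighbours (In_neq' \<circ> Copy4) Term_u (In_neq' (X 4)) n"

primrec eq_neighbours :: "gadget_vertex \<Rightarrow> G_vertex list" where
  "eq_neighbours (X i) =
     [[Term_v, In_eq (Y 1), In_eq (X 2)], map In_eq [X 1, X 3, X 4],
      map In_eq [X 2, Copy3 (NU 6)], map In_eq [X 2, Copy4 (NU 6)]] ! (i - 1)"
| "eq_neighbours (Y i) =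
     [[Term_u, In_eq (Y 2), In_eq (X 1)],
      map In_eq [Y 1, Copy3 (NU 1), Copy4 (NU 1)]] ! (i - 1)"
| "eq_neighbours (Copy3 n) = neq_neighbours (In_eq \<circ> Copy3) (In_eq (Y 2)) (In_eq (X 3)) n"
| "eq_neighbours (Copy4 n) = neq_neighbours (In_eq \<circ> Copy4) (In_eq (Y 2)) (In_eq (X 4)) n"

primrec G_neighbours :: "G_vertex \<Rightarrow> G_vertex list" where
  "G_neighbours Term_u = [In_neq' (Copy3 (NU 1)), In_neq' (Copy4 (NU 1)), In_eq (Y 1)]"
| "G_neighbours Term_v = [In_neq' (X 1), In_eq (X 1)]"
| "G_neighbours (In_neq' x) = neq'_neighbours x"
| "G_neighbours (In_eq x) = eq_neighbours x"

text \<open>Completeness of the tables makes them sound for both uses: their lengths bound degrees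
  from above, and walks along them include all walks of the graph.\<close>

lemma G_neighbours_edge:
  assumes "{x, y} \<in> edges G_graph"
  shows "y \<in> set (G_neighbours x)"
proof -
  have "list_all (\<lambda>(x, y). y \<in> set (G_neighbours x) \<and> x \<in> set (G_neighbours y)) G_links"
    by code_simp
  then show ?thesis
    using assms by (auto simp: edges_G_graph undirected_def list_all_iff doubleton_eq_iff)
qed

lemma vertex_degree_le:
  assumes "simple_graph G" "\<And>x y. {x, y} \<in> edges G \<Longrightarrow> y \<in> set (nbrs x)"
  shows "vertex_degree G v \<le> length (nbrs v)"
proof -
  have "{e \<in> edges G. v \<in> e} \<subseteq> (\<lambda>y. {v, y}) ` set (nbrs v)"
  proof
    fix e assume e: "e \<in> {e \<in> edges G. v \<in> e}"
    then obtain x y where "e = {x, y}"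
      using assms(1) by (auto simp: simple_graph_def)
    with e obtain w where "e = {v, w}"
      by auto
    with e assms(2) show "e \<in> (\<lambda>y. {v, y}) ` set (nbrs v)"
      by auto
  qed
  then have "vertex_degree G v \<le> card ((\<lambda>y. {v, y}) ` set (nbrs v))"
    unfolding vertex_degree_def by (intro card_mono) auto
  also have "\<dots> \<le> length (nbrs v)"
    using card_image_le [of "set (nbrs v)"] card_length [of "nbrs v"] by (meson finite_set order_trans)
  finally show ?thesis .
qed

lemma subcubic_G_graph: "subcubic G_graph"
proof -
  have "list_all (\<lambda>v. length (G_neighbours v) \<le> 3) G_vertices"
    by code_simp
  then have le: "vertex_degree G_graph v \<le> 3" if "v \<in> verts G_graph" for v
    using that vertex_degree_le [OF simple_graph_G_graph, of G_neighbours v] G_neighbours_edge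
    by (fastforce simp: list_all_iff verts_G_graph_list)
  \<comment> \<open>A maximum of exactly 3 needs a vertex attaining it: \<open>X 2\<close> with its
    three neighbours.\<close>
  let ?x = "\<lambda>i. In_eq (X i)"
  let ?star = "{{?x 2, ?x 1}, {?x 2, ?x 3}, {?x 2, ?x 4}}"
  have "?x 2 \<in> verts G_graph"
    unfolding verts_G_graph_list by (simp add: G_vertices_def)
  have "finite (edges G_graph)"
    by (simp add: edges_G_graph undirected_def)
  moreover have "?star \<subseteq> edges G_graph"
    unfolding edges_G_graph insert_subset linked_iff_edge [symmetric] linked_iff
    by (auto simp: G_links_def)
  ultimately have "card ?star \<le> vertex_degree G_graph (?x 2)"
    unfolding vertex_degree_def by (intro card_mono) auto
  moreover have "card ?star = 3"
    by (simp add: doubleton_eq_iff)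
  ultimately have "vertex_degree G_graph (?x 2) = 3"
    using le [OF \<open>?x 2 \<in> verts G_graph\<close>] by simp
  with \<open>?x 2 \<in> verts G_graph\<close> have "3 \<in> vertex_degree G_graph ` verts G_graph"
    by (metis imageI)
  then have "max_degree G_graph = 3"
    unfolding max_degree_def using le simple_graph_G_graph
    by (intro Max_eqI) (auto simp: simple_graph_def)
  then show ?thesis
    by (simp add: subcubic_def)
qed

section \<open>Cycles and bounded walks\<close>

lemma path_edges_snoc: "path_edges (xs @ [x, y]) = insert {x, y} (path_edges (xs @ [x]))"
  by (induction xs rule: path_edges.induct) auto

lemma cycle_edges_rotate1: "cycle_edges (rotate1 xs) = cycle_edges xs"
proof (cases xs rule: path_edges.cases)
  case (1 x y zs)
  then show ?thesis
    using path_edges_snoc [of "y # zs" x y] by (simp add: cycle_edges_def)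
qed (simp_all add: cycle_edges_def)

lemma is_cycle_rotate: "is_cycle G (rotate n xs) \<longleftrightarrow> is_cycle G xs"
proof -
  have "cycle_edges (rotate n xs) = cycle_edges xs"
    by (induction n) (simp_all add: cycle_edges_rotate1)
  then show ?thesis
    by (simp add: is_cycle_def)
qed

text \<open>Here \<open>r\<close> is the root, \<open>x\<close> the previous and \<open>y\<close>
  the current vertex, and \<open>n\<close> the number of steps left. Only immediate reversal is
  forbidden, so no visited set is kept; the walks examined include all relevant paths.\<close>

fun no_return :: "('a \<Rightarrow> 'a list) \<Rightarrow> ('a \<Rightarrow> int) \<Rightarrow> 'a \<Rightarrow> nat \<Rightarrow> 'a \<Rightarrow> 'a \<Rightarrow> bool" where
  "no_return nbrs ord r 0 x y = True"
| "no_return nbrs ord r (Suc n) x y =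
     list_all (\<lambda>z. z \<noteq> r \<and> no_return nbrs ord r n y z)
       (filter (\<lambda>z. z \<noteq> x \<and> ord r \<le> ord z) (nbrs y))"

text \<open>Distinctness excludes reversals and the rank condition keeps every step admissible, so
  the search would follow \<open>zs\<close> to \<open>r\<close>. From \<open>y\<close> this takes
  \<open>length zs + 1\<close> steps, whence the strict bound. For empty \<open>zs\<close> the step
  to \<open>r\<close> is no reversal because \<open>x \<noteq> r\<close>; the premise
  \<open>y \<noteq> r\<close> preserves this in the induction.\<close>

lemma no_return_path:
  assumes "no_return nbrs ord r n x y"
    and "path_edges (y # zs @ [r]) \<subseteq> E" and "\<And>v w. {v, w} \<in> E \<Longrightarrow> w \<in> set (nbrs v)"
    and "distinct (x # y # zs)" and "zs = [] \<Longrightarrow> x \<noteq> r" and "y \<noteq> r"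
    and "\<And>z. z \<in> set zs \<Longrightarrow> ord r \<le> ord z" and "length zs < n"
  shows False
  using assms(1,2,4-)
proof (induction zs arbitrary: n x y)
  case Nil
  then obtain m where "n = Suc m" by (cases n) auto
  with Nil assms(3) [of y r] show ?case by (auto simp: list_all_iff)
next
  case (Cons z zs)
  then obtain m where n: "n = Suc m" by (cases n) auto
  have "z \<in> set (nbrs y)" using Cons.prems(2) assms(3) [of y z] by simp
  with Cons.prems(1,3,6) n have "no_return nbrs ord r m y z" "z \<noteq> r"
    by (auto simp: list_all_iff)
  then show ?case
    using Cons.prems n by (intro Cons.IH [of m y z]) auto
qed

lemma girth_ge:
  fixes nbrs :: "'a \<Rightarrow> 'a list" and ord :: "'a \<Rightarrow> int"
  assumes nbrs: "\<And>x y. {x, y} \<in> edges G \<Longrightarrow> y \<in> set (nbrs x)"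
    and walks: "\<And>r x. r \<in> verts G \<Longrightarrow> x \<in> set (nbrs r) \<Longrightarrow> ord r \<le> ord x \<Longrightarrow>
       no_return nbrs ord r n r x"
  shows "enat (n + 2) \<le> girth G"
  unfolding girth_def
proof (rule INF_greatest)
  fix p
  assume "p \<in> {p. is_cycle G p}"
  then have p: "is_cycle G p" by simp
  then have "p \<noteq> []" by (auto simp: is_cycle_def)
  define m where "m = Min (ord ` set p)"
  have "m \<in> ord ` set p"
    unfolding m_def using \<open>p \<noteq> []\<close> by (intro Min_in) auto
  then obtain i where i: "i < length p" "ord (p ! i) = m"
    by (auto simp: in_set_conv_nth)
  define q where "q = rotate i p"
  have q: "is_cycle G q" "length q = length p" "set q = set p"
    by (simp_all add: q_def is_cycle_rotate p)
  have hd: "hd q = p ! i"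
    using i \<open>p \<noteq> []\<close> by (simp add: q_def hd_rotate_conv_nth)
  \<comment> \<open>A cycle has at least 3 vertices, so \<open>zs\<close> is nonempty. This settles
    the premise of \<open>no_return_path\<close> about empty \<open>zs\<close>, where the previous
    vertex is now \<open>r\<close> itself.\<close>
  obtain r x zs where rx: "q = r # x # zs" "zs \<noteq> []"
    using q(1) unfolding is_cycle_def by (cases q rule: path_edges.cases) (auto simp: Suc_le_eq)
  have min: "ord r \<le> ord y" if "y \<in> set p" for y
    using hd i(2) rx that by (auto simp: m_def)
  have edges: "path_edges (r # x # zs @ [r]) \<subseteq> edges G"
    using q(1) rx by (simp add: is_cycle_def cycle_edges_def)
  show "enat (n + 2) \<le> enat (length p)"
  proof (rule ccontr)
    assume "\<not> enat (n + 2) \<le> enat (length p)"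
    \<comment> \<open>The root and the first step precede the search, which accounts for the offset
      2.\<close>
    then have "length zs < n" using q(2) rx by simp
    have "no_return nbrs ord r n r x"
      using edges nbrs rx q(1,3) min by (intro walks) (auto simp: is_cycle_def)
    then show False
      by (rule no_return_path [where E = "edges G" and zs = zs])
        (use edges nbrs rx q min \<open>length zs < n\<close> in \<open>auto simp: is_cycle_def\<close>)
  qed
qed

text \<open>Removing the terminals and the ring of each copy leaves a forest, so ranking these first
  keeps the number of walks small.\<close>

primrec neq_rank :: "neq_vertex \<Rightarrow> int" where
  "neq_rank (NU i) = int i"
| "neq_rank (NV i) = 6 + int i"
| "neq_rank (NT i) = 14 + int i"
| "neq_rank (NW i) = 18 + int i"
| "neq_rank (NT' i) = 22 + int i"
| "neq_rank (NT'' i) = 26 + int i"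
| "neq_rank (NW' i) = 30 + int i"
| "neq_rank (NW'' i) = 34 + int i"

primrec gadget_rank :: "gadget_vertex \<Rightarrow> int" where
  "gadget_rank (X i) = int i"
| "gadget_rank (Y i) = 4 + int i"
| "gadget_rank (Copy3 n) = 10 + neq_rank n"
| "gadget_rank (Copy4 n) = 50 + neq_rank n"

primrec G_rank :: "G_vertex \<Rightarrow> int" where
  "G_rank Term_u = 0"
| "G_rank Term_v = 1"
| "G_rank (In_neq' x) = 10 + gadget_rank x"
| "G_rank (In_eq x) = 110 + gadget_rank x"

text \<open>Depth 9 is the girth 11 minus the offset 2 of \<open>girth_ge\<close>.\<close>

lemma G_walks: "list_all (\<lambda>r. list_all (no_return G_neighbours G_rank r 9 r)
    (filter (\<lambda>x. G_rank r \<le> G_rank x) (G_neighbours r))) G_vertices"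
  by code_simp

lemma girth_G_graph: "girth G_graph = 11"
proof (rule antisym)
  have "enat (9 + 2) \<le> girth G_graph"
  proof (rule girth_ge)
    show "y \<in> set (G_neighbours x)" if "{x, y} \<in> edges G_graph" for x y
      using that by (rule G_neighbours_edge)
    show "no_return G_neighbours G_rank r 9 r x"
      if "r \<in> verts G_graph" "x \<in> set (G_neighbours r)" "G_rank r \<le> G_rank x" for r x
      using G_walks that by (auto simp: list_all_iff verts_G_graph_list)
  qed
  then show "11 \<le> girth G_graph"
    by (simp add: numeral_eq_enat)
  \<comment> \<open>The ring of one copy attains the lower bound.\<close>
  define p where "p = map (In_eq \<circ> Copy3)
    [NU 1, NU 2, NU 3, NU 4, NU 5, NU 6, NV 1, NV 2, NV 3, NV 4, NV 5]"
  have "cycle_edges p \<subseteq> edges G_graph"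
    unfolding p_def G_graph_def eq_gadget_def graph_union_def ugraph.simps neq_gadget_def by blast
  moreover have "set p \<subseteq> verts G_graph"
    unfolding verts_G_graph_list by (auto simp: p_def G_vertices_def neq_vertices_def)
  ultimately have "is_cycle G_graph p"
    by (simp add: is_cycle_def) (simp add: p_def)
  then have "girth G_graph \<le> enat (length p)"
    unfolding girth_def by (intro INF_lower) simp
  moreover have "length p = 11"
    by (simp add: p_def)
  ultimately show "girth G_graph \<le> 11"
    by (simp add: numeral_eq_enat)
qed

section \<open>Colourings\<close>

text \<open>Distance 1 or 2, written as searches of the link list so that it can be evaluated;
  \<open>close_iff\<close> restores the middle vertex.\<close>

definition close :: "('a \<times> 'a) list \<Rightarrow> 'a \<Rightarrow> 'a \<Rightarrow> bool" where
  "close es x y \<longleftrightarrow> x \<noteq> y \<and> (linked es x y \<or>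
     list_ex (\<lambda>(v, w). v = x \<and> linked es w y \<or> w = x \<and> linked es v y) es)"

text \<open>\<open>Colour v ns p\<close> colours \<open>v\<close> differently from the vertices \<open>ns\<close> before
  continuing with \<open>p\<close>; the parts of \<open>Both p q\<close> are searched independently.\<close>

datatype 'v plan = Done | Colour 'v "'v list" "'v plan" | Both "'v plan" "'v plan"

primrec feasible :: "'v plan \<Rightarrow> ('v \<times> nat) list \<Rightarrow> bool" where
  "feasible Done s = True"
| "feasible (Colour v ns p) s =
     list_ex (\<lambda>k. feasible p ((v, k) # s))
       (filter (\<lambda>k. list_all (\<lambda>w. map_of s w \<noteq> Some k) ns) [0, 1, 2, 3])"
| "feasible (Both p q) s = (if feasible p s then feasible q s else False)"

primrec plan_pairs :: "'v plan \<Rightarrow> ('v \<times> 'v) list" where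
  "plan_pairs Done = []"
| "plan_pairs (Colour v ns p) = map (Pair v) ns @ plan_pairs p"
| "plan_pairs (Both p q) = plan_pairs p @ plan_pairs q"

text \<open>Choosing \<open>d v\<close> at every step steers the search to success, so infeasibility
  refutes \<open>d\<close>. The branches of \<open>Both\<close> ignore constraints between them,
  such as the one between \<open>NT 4\<close> and \<open>NW 4\<close>, which only makes the search
  more permissive.\<close>

lemma feasible_if_proper:
  assumes "\<And>v w. (v, w) \<in> set (plan_pairs p) \<Longrightarrow> d v \<noteq> d w"
    and "\<And>v. d v < (4::nat)" and "\<And>v k. map_of s v = Some k \<Longrightarrow> k = d v"
  shows "feasible p s"
  using assms(1,3)
proof (induction p arbitrary: s)
  case (Colour v ns p)
  have "d v \<in> {0, 1, 2, 3}" using assms(2) [of v] by auto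
  moreover have "feasible p ((v, d v) # s)"
    using Colour.prems by (intro Colour.IH) (auto split: if_splits)
  moreover have "map_of s w \<noteq> Some (d v)" if "w \<in> set ns" for w
    using Colour.prems that by fastforce
  ultimately show ?case by (force simp: list_ex_iff list_all_iff)
qed auto

definition colour_all :: "('v \<times> 'v list) list \<Rightarrow> 'v plan \<Rightarrow> 'v plan" where
  "colour_all vs p = foldr (\<lambda>(v, ns). Colour v ns) vs p"

text \<open>After the ring, the parts named \<open>t\<close> and \<open>w\<close> only interact through the colours
  already chosen. The terminals are named \<open>NU 0\<close> and \<open>NV 0\<close>.\<close>

definition neq_plan :: "neq_vertex plan" where
  "neq_plan =
    colour_all
      [(NU 3, [NU 1, NU 2]), (NU 4, [NU 2, NU 3]), (NU 5, [NV 0, NU 3, NU 4]),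
       (NU 6, [NV 0, NU 4, NU 5]), (NV 1, [NV 0, NU 5, NU 6]), (NV 2, [NU 6, NV 1]),
       (NV 3, [NV 5, NV 1, NV 2]), (NV 4, [NU 1, NV 5, NV 2, NV 3]),
       (NV 8, [NU 1, NV 5, NV 4]), (NV 6, [NU 6, NV 1, NV 2]), (NV 7, [NV 2, NV 3, NV 4])]
      (Both
        (colour_all
          [(NT 1, [NU 2, NU 3, NU 4]), (NT 2, [NU 3, NT 1]), (NT 3, [NV 7, NT 1, NT 2]),
           (NT 4, [NV 3, NV 7, NT 2, NT 3])]
          (Both
            (colour_all
              [(NT' 1, [NT 1, NT 2, NT 3]), (NT' 2, [NT 2, NT' 1]),
               (NT' 4, [NV 5, NV 8, NT' 2]), (NT' 3, [NV 8, NT' 1, NT' 2, NT' 4])] Done)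
            (colour_all
              [(NT'' 1, [NT 2, NT 3, NT 4]), (NT'' 2, [NT 3, NT'' 1]),
               (NT'' 4, [NV 5, NV 8, NT'' 2]), (NT'' 3, [NV 8, NT'' 1, NT'' 2, NT'' 4])] Done)))
        (colour_all
          [(NW 1, [NU 3, NU 4, NU 5]), (NW 2, [NU 4, NW 1]), (NW 3, [NV 7, NW 1, NW 2]),
           (NW 4, [NV 3, NV 7, NW 2, NW 3])]
          (Both
            (colour_all
              [(NW' 1, [NW 1, NW 2, NW 3]), (NW' 2, [NW 2, NW' 1]),
               (NW' 4, [NV 1, NV 6, NW' 2]), (NW' 3, [NV 6, NW' 1, NW' 2, NW' 4])] Done)
            (colour_all
              [(NW'' 1, [NW 2, NW 3, NW 4]), (NW'' 2, [NW 3, NW'' 1]),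
               (NW'' 4, [NV 1, NV 6, NW'' 2]), (NW'' 3, [NV 6, NW'' 1, NW'' 2, NW'' 4])] Done))))"

text \<open>Up to renaming colours, \<open>NU 1\<close> and its neighbours are coloured as shown;
  \<open>NV 0\<close> gets the colour of \<open>NU 0\<close>, which is the assumption to be
  refuted.\<close>

lemma neq_plan_infeasible:
  "\<not> feasible neq_plan [(NV 5, 3), (NU 2, 2), (NU 1, 1), (NU 0, 0), (NV 0, 0)]"
  by code_simp

lemma neq_plan_pairs:
  "list_all (\<lambda>(x, y). close (neq_links id (NU 0) (NV 0)) x y) (plan_pairs neq_plan)"
  by code_simp

lemma neq_colouring:
  assumes "\<And>x y. close (neq_links id (NU 0) (NV 0)) x y \<Longrightarrow> d x \<noteq> d y" and "\<And>x. d x < (4::nat)"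
  shows "d (NU 0) \<noteq> d (NV 0)"
proof
  assume eq: "d (NU 0) = d (NV 0)"
  \<comment> \<open>Renames the colours of a vertex and its three neighbours to the ones fixed in the search.\<close>
  define f where "f k = (if k = d (NU 0) then 0 else if k = d (NU 1) then 1 else
     if k = d (NU 2) then 2 else 3::nat)" for k
  have "list_all (\<lambda>(x, y). close (neq_links id (NU 0) (NV 0)) x y)
    [(NU 0, NU 1), (NU 0, NU 2), (NU 0, NV 5), (NU 1, NU 2), (NU 1, NV 5), (NU 2, NV 5)]"
    by code_simp
  then have ne: "d (NU 0) \<noteq> d (NU 1)" "d (NU 0) \<noteq> d (NU 2)" "d (NU 0) \<noteq> d (NV 5)"
    "d (NU 1) \<noteq> d (NU 2)" "d (NU 1) \<noteq> d (NV 5)" "d (NU 2) \<noteq> d (NV 5)"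
    using assms(1) by auto
  \<comment> \<open>Four distinct colours below 4 are all of them, so the default 3 of
    \<open>f\<close> is reached by \<open>d (NV 5)\<close> alone and \<open>f\<close> is injective
    on the colours.\<close>
  have "d ` {NU 0, NU 1, NU 2, NV 5} = {..<4}"
    using ne assms(2) by (intro card_subset_eq) auto
  then have f: "f k \<noteq> f l" if "k \<noteq> l" "k < 4" "l < 4" for k l
  proof -
    have "k \<in> d ` {NU 0, NU 1, NU 2, NV 5}" "l \<in> d ` {NU 0, NU 1, NU 2, NV 5}"
      unfolding \<open>d ` {NU 0, NU 1, NU 2, NV 5} = {..<4}\<close> using that by simp_all
    then show ?thesis
      using ne that(1) by (auto simp: f_def)
  qed
  have "feasible neq_plan [(NV 5, 3), (NU 2, 2), (NU 1, 1), (NU 0, 0), (NV 0, 0)]"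
  proof (rule feasible_if_proper [where d = "f \<circ> d"])
    show "(f \<circ> d) v \<noteq> (f \<circ> d) w" if "(v, w) \<in> set (plan_pairs neq_plan)" for v w
      using neq_plan_pairs that assms f by (auto simp: list_all_iff)
    show "(f \<circ> d) v < 4" for v
      by (simp add: f_def)
    show "k = (f \<circ> d) v"
      if "map_of [(NV 5, 3), (NU 2, 2), (NU 1, 1), (NU 0, 0), (NV 0, 0)] v = Some k" for v k
      using that ne eq by (auto simp: f_def split: if_splits)
  qed
  with neq_plan_infeasible show False by simp
qed

section \<open>Transfer from the gadget to its copies\<close>

lemma close_iff:
  "close es x y \<longleftrightarrow> x \<noteq> y \<and> (linked es x y \<or> (\<exists>z. linked es x z \<and> linked es z y))"
  unfolding close_def linked_iff list_ex_iff by (auto; blast)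

text \<open>Every copy renames one generic gadget, so a single search serves all four.
  \<open>NU 0\<close> and \<open>NV 0\<close> are not inner vertices and are free to name the
  terminals.\<close>

lemma neq_links_natural:
  assumes "h (NU 0) = a" "h (NV 0) = b" "\<And>x. x \<in> neq_inner \<Longrightarrow> h x = c x"
  shows "neq_links c a b = map (map_prod h h) (neq_links id (NU 0) (NV 0))"
  using assms by (simp add: neq_links_def successive_def neq_inner_def)

text \<open>Closeness survives injective renaming and the addition of links, so a colouring of the
  whole graph pulls back to the generic gadget.\<close>

lemma neq_gadget_colouring:
  assumes "inj c" "a \<notin> range c" "b \<notin> range c" "a \<noteq> b"
    and links: "set (neq_links c a b) \<subseteq> set es"
    and proper: "\<And>x y. close es x y \<Longrightarrow> d x \<noteq> d y" and "\<And>x. d x < (4::nat)"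
  shows "d a \<noteq> d b"
proof -
  define h where "h = c(NU 0 := a, NV 0 := b)"
  have "inj h"
    using assms(1-4) by (auto simp: h_def inj_def)
  have "neq_links c a b = map (map_prod h h) (neq_links id (NU 0) (NV 0))"
    by (rule neq_links_natural) (auto simp: h_def neq_inner_def)
  with links have "linked es (h x) (h y)" if "linked (neq_links id (NU 0) (NV 0)) x y" for x y
    using that by (force simp: linked_iff)
  with \<open>inj h\<close> have "close es (h x) (h y)" if "close (neq_links id (NU 0) (NV 0)) x y" for x y
    using that unfolding close_iff by (auto simp: inj_eq; blast)
  then have "(d \<circ> h) (NU 0) \<noteq> (d \<circ> h) (NV 0)"
    using proper assms(7) by (intro neq_colouring) auto
  then show ?thesis
    by (simp add: h_def)
qed

lemma graph_dist_le_2: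
  assumes "close es x y" "edges G = undirected es" "verts G = endpoints es"
    and "\<And>x y. (x, y) \<in> set es \<Longrightarrow> x \<noteq> y"
  shows "graph_dist G x y \<le> 2"
proof -
  have bound: "graph_dist G x y \<le> enat (length p - 1)" if "is_path G p" "hd p = x" "last p = y" for p
    unfolding graph_dist_def using that by (intro INF_lower) auto
  have link: "{v, w} \<in> edges G \<and> v \<in> verts G \<and> w \<in> verts G \<and> v \<noteq> w" if "linked es v w" for v w
  proof (intro conjI)
    show "{v, w} \<in> edges G"
      using that by (simp add: assms(2) linked_iff_edge)
    show "v \<in> verts G" "w \<in> verts G"
      using that by (force simp: assms(3) linked_iff endpoints_def)+
    show "v \<noteq> w"
      using that assms(4) by (auto simp: linked_iff)
  qed
  consider "linked es x y" | z where "linked es x z" "linked es z y" "x \<noteq> y"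
    using assms(1) by (auto simp: close_iff)
  then show ?thesis
  proof cases
    case 1
    then have "graph_dist G x y \<le> enat (length [x, y] - 1)"
      using link by (intro bound) (auto simp: is_path_def)
    also have "\<dots> \<le> 2"
      by (simp add: numeral_eq_enat)
    finally show ?thesis .
  next
    case 2
    then have "graph_dist G x y \<le> enat (length [x, z, y] - 1)"
      using link by (intro bound) (auto simp: is_path_def)
    then show ?thesis
      by (simp add: numeral_eq_enat numeral_2_eq_2)
  qed
qed

section \<open>Four colours on the whole graph\<close>

lemma four_colours_exhausted:
  fixes a b c d e :: nat
  assumes "distinct [a, b, c, d]" "a < 4" "b < 4" "c < 4" "d < 4" "e < 4"
  shows "e \<in> {a, b, c, d}"
proof -
  have "{a, b, c, d} = {..<4}"
    using assms by (intro card_subset_eq) auto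
  with assms(6) show ?thesis by simp
qed

lemma G_not_4_colourable: "\<not> two_distance_colorable G_graph 4"
proof
  assume "two_distance_colorable G_graph 4"
  then obtain col where col: "two_distance_coloring G_graph 4 col"
    by (auto simp: two_distance_colorable_def)
  \<comment> \<open>The value 0 off the graph makes the bound below 4 hold everywhere, as
    \<open>neq_gadget_colouring\<close> demands.\<close>
  define d where "d x = (if x \<in> verts G_graph then col x else 0)" for x
  have less: "d x < 4" for x
    using col by (auto simp: d_def two_distance_coloring_def)
  have proper: "d x \<noteq> d y" if "close G_links x y" for x y
  proof -
    have "x \<in> verts G_graph" "y \<in> verts G_graph" "x \<noteq> y"
      using that by (force simp: close_iff linked_iff verts_G_graph endpoints_def)+
    moreover have "graph_dist G_graph x y \<le> 2"
      using that edges_G_graph verts_G_graph G_links_loopless by (rule graph_dist_le_2)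
    ultimately show ?thesis
      using col by (auto simp: d_def two_distance_coloring_def)
  qed
  have gadget: "d a \<noteq> d b"
    if "inj c" "a \<notin> range c" "b \<notin> range c" "a \<noteq> b" "set (neq_links c a b) \<subseteq> set G_links" for a b c
    using that proper less by (rule neq_gadget_colouring)
  have neq': "d Term_u \<noteq> d (In_neq' (X 3))" "d Term_u \<noteq> d (In_neq' (X 4))"
    and eq: "d (In_eq (Y 2)) \<noteq> d (In_eq (X 3))" "d (In_eq (Y 2)) \<noteq> d (In_eq (X 4))"
    using gadget [of "In_neq' \<circ> Copy3" Term_u "In_neq' (X 3)"]
      gadget [of "In_neq' \<circ> Copy4" Term_u "In_neq' (X 4)"]
      gadget [of "In_eq \<circ> Copy3" "In_eq (Y 2)" "In_eq (X 3)"]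
      gadget [of "In_eq \<circ> Copy4" "In_eq (Y 2)" "In_eq (X 4)"]
    unfolding G_links_def set_append
    by (simp_all add: inj_def image_iff le_supI1 le_supI2 subset_insertI2)
  have linked:
    "linked G_links Term_v (In_neq' (X 1))" "linked G_links (In_neq' (X 1)) (In_neq' (X 2))"
    "linked G_links (In_neq' (X 2)) (In_neq' (X 3))" "linked G_links (In_neq' (X 2)) (In_neq' (X 4))"
    "linked G_links Term_u (In_eq (Y 1))" "linked G_links (In_eq (Y 1)) (In_eq (Y 2))"
    "linked G_links (In_eq (Y 1)) (In_eq (X 1))" "linked G_links Term_v (In_eq (X 1))"
    "linked G_links (In_eq (X 1)) (In_eq (X 2))"
    "linked G_links (In_eq (X 2)) (In_eq (X 3))" "linked G_links (In_eq (X 2)) (In_eq (X 4))"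
    by (auto simp: linked_iff G_links_def)
  have sym: "linked G_links y x" if "linked G_links x y" for x y
    using that by (auto simp: linked_iff)
  have adj: "d x \<noteq> d y" if "linked G_links x y" for x y
    using that G_links_loopless by (intro proper) (auto simp: close_iff linked_iff)
  have cherry: "d x \<noteq> d y \<and> d x \<noteq> d z \<and> d y \<noteq> d z"
    if "linked G_links x y" "linked G_links y z" "x \<noteq> z" for x y z
    using that adj [OF that(1)] adj [OF that(2)] proper [of x z] by (auto simp: close_iff)
  note n = cherry [OF linked(1) linked(2)] cherry [OF linked(2) linked(3)]
    cherry [OF linked(2) linked(4)] cherry [OF sym [OF linked(3)] linked(4)]
  note e = cherry [OF linked(5) linked(6)] cherry [OF linked(5) linked(7)]
    cherry [OF sym [OF linked(6)] linked(7)] cherry [OF linked(8) linked(9)]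
    cherry [OF linked(8) sym [OF linked(7)]] cherry [OF linked(7) linked(9)]
    cherry [OF linked(9) linked(10)] cherry [OF linked(9) linked(11)]
    cherry [OF sym [OF linked(10)] linked(11)]
  have "distinct [d (In_neq' (X 1)), d (In_neq' (X 2)), d (In_neq' (X 3)), d (In_neq' (X 4))]"
    using n by simp
  from four_colours_exhausted [OF this less less less less less [of Term_u]]
  have "d Term_u = d (In_neq' (X 1)) \<or> d Term_u = d (In_neq' (X 2))"
    using neq' by simp
  then have "d Term_u \<noteq> d Term_v"
    using n(1) by auto
  moreover have "d Term_u = d Term_v"
  proof -
    have "distinct [d (In_eq (X 1)), d (In_eq (X 2)), d (In_eq (X 3)), d (In_eq (X 4))]"
      using e by simp
    from four_colours_exhausted [OF this less less less less less [of "In_eq (Y 2)"]]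
    \<comment> \<open>The gadget copies exclude the colours of \<open>X 3\<close> and
      \<open>X 4\<close>, and the common neighbour \<open>Y 1\<close> excludes that of
      \<open>X 1\<close>.\<close>
    have "d (In_eq (Y 2)) = d (In_eq (X 2))"
      using e(3) eq by auto
    \<comment> \<open>\<open>Term_u\<close> avoids the colour of \<open>X 2\<close> because it is
      close to \<open>Y 2\<close>; \<open>Term_v\<close> avoids it by being close to
      \<open>X 2\<close> itself.\<close>
    then have "distinct [d (In_eq (X 1)), d (In_eq (X 2)), d (In_eq (Y 1)), d Term_u]"
      using e(1-6) by auto
    from four_colours_exhausted [OF this less less less less less [of Term_v]]
    show ?thesis
      using e(4,5) by auto
  qed
  ultimately show False ..
qed

text \<open>An injective colouring shows that the least number of colours is attained, and a
  colouring with at most \<open>k\<close> colours is also one with \<open>k\<close>.\<close>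

lemma chi2_ge:
  assumes "finite (verts G)" "\<not> two_distance_colorable G k"
  shows "Suc k \<le> chi2 G"
proof -
  obtain f :: "'a \<Rightarrow> nat" where "bij_betw f (verts G) {0..<card (verts G)}"
    using ex_bij_betw_finite_nat [OF assms(1)] by blast
  then have "two_distance_coloring G (card (verts G)) f"
    by (auto simp: two_distance_coloring_def bij_betw_def inj_on_def)
  then have "\<exists>k. two_distance_colorable G k"
    unfolding two_distance_colorable_def by blast
  then have "two_distance_colorable G (chi2 G)"
    unfolding chi2_def by (rule LeastI_ex)
  then obtain c where "two_distance_coloring G (chi2 G) c"
    unfolding two_distance_colorable_def by blast
  then have "two_distance_coloring G k c" if "chi2 G \<le> k"
    using that unfolding two_distance_coloring_def by (meson order_less_le_trans)
  then have "two_distance_colorable G k" if "chi2 G \<le> k"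
    using that unfolding two_distance_colorable_def by blast
  with assms(2) show ?thesis
    by (meson not_less_eq_eq)
qed

theorem lemma19:
  shows "simple_graph G_graph \<and> planar G_graph \<and> subcubic G_graph \<and> girth G_graph = 11 \<and>
    chi2 G_graph \<ge> 5 \<and> \<not> two_distance_colorable G_graph 4"
proof -
  have "Suc 4 \<le> chi2 G_graph"
    using simple_graph_G_graph G_not_4_colourable by (intro chi2_ge) (auto simp: simple_graph_def)
  then show ?thesis
    using simple_graph_G_graph planar_G_graph subcubic_G_graph girth_G_graph G_not_4_colourable by simp
qed

end
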